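(* Let $\{G_n\}_{n=1}^{\infty}$ be a countable family of locally compact Polish groups and let $G=\prod_{n=1}^{\infty}G_n$, equipped with the product topology and the coordinatewise group operation. Then $G$ is fattening.
   Context: Let $G$ be a Hausdorff topological group with unit $e$ and let $E\subseteq G$. $E$ is called compactivorous if for every nonempty compact set $K\subseteq G$ there are an open set $V\subseteq G$ and $g,h\in G$ such that $K\cap V\neq\varnothing$ and $g(K\cap V)h\subseteq E$. $E$ is called strongly compactivorous if there is a closed neighbourhood $U$ of $e$ such that, for every compact set $K\subseteq U$, there are $g,h\in G$ such that $gKh\subseteq E$. $G$ is called fattening if every compactivorous subset of $G$ is strongly compactivorous. A Polish group is a topological group whose topology is separable and completely metrizable. *)

theory Defs
  imports "HOL-Analysis.Analysis" "HOL-Algebra.Product_Groups"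
begin

definition topological_group :: "('a, 'm) monoid_scheme \<Rightarrow> 'a topology \<Rightarrow> bool" where
  "topological_group G T \<longleftrightarrow>
     group G \<and> topspace T = carrier G \<and>
     continuous_map (prod_topology T T) T (\<lambda>(x, y). x \<otimes>\<^bsub>G\<^esub> y) \<and>
     continuous_map T T (\<lambda>x. inv\<^bsub>G\<^esub> x)"

definition separable_space :: "'a topology \<Rightarrow> bool" where
  "separable_space T \<longleftrightarrow>
     (\<exists>C. countable C \<and> C \<subseteq> topspace T \<and> T closure_of C = topspace T)"

definition polish_group :: "('a, 'm) monoid_scheme \<Rightarrow> 'a topology \<Rightarrow> bool" where
  "polish_group G T \<longleftrightarrow>
     topological_group G T \<and> separable_space T \<and> completely_metrizable_space T"

definition compactivorous :: "('a, 'm) monoid_scheme \<Rightarrow> 'a topology \<Rightarrow> 'a set \<Rightarrow> bool" where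
  "compactivorous G T E \<longleftrightarrow>
     E \<subseteq> carrier G \<and>
     (\<forall>K. compactin T K \<and> K \<noteq> {} \<longrightarrow>
        (\<exists>V. openin T V \<and>
           (\<exists>g\<in>carrier G. \<exists>h\<in>carrier G.
              K \<inter> V \<noteq> {} \<and> (\<lambda>x. g \<otimes>\<^bsub>G\<^esub> x \<otimes>\<^bsub>G\<^esub> h) ` (K \<inter> V) \<subseteq> E)))"

definition strongly_compactivorous :: "('a, 'm) monoid_scheme \<Rightarrow> 'a topology \<Rightarrow> 'a set \<Rightarrow> bool" where
  "strongly_compactivorous G T E \<longleftrightarrow>
     E \<subseteq> carrier G \<and>
     (\<exists>U. closedin T U \<and> \<one>\<^bsub>G\<^esub> \<in> T interior_of U \<and>
        (\<forall>K. compactin T K \<and> K \<subseteq> U \<longrightarrow>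
           (\<exists>g\<in>carrier G. \<exists>h\<in>carrier G.
              (\<lambda>x. g \<otimes>\<^bsub>G\<^esub> x \<otimes>\<^bsub>G\<^esub> h) ` K \<subseteq> E)))"

text \<open>Being fattening is only meaningful for Hausdorff topological groups, so this is
  part of the predicate and hence also of any claim that a group is fattening.\<close>

definition fattening :: "('a, 'm) monoid_scheme \<Rightarrow> 'a topology \<Rightarrow> bool" where
  "fattening G T \<longleftrightarrow>
     topological_group G T \<and> Hausdorff_space T \<and>
     (\<forall>E. compactivorous G T E \<longrightarrow> strongly_compactivorous G T E)"

end

theory Submission
  imports Defs
begin

text \<open>
  Fix a complete metric for the product and suppose \<open>E\<close> is not strongly compactivorous.
  Then every neighbourhood of the unit contains a compact set without a two-sided translate
  inside \<open>E\<close>, so one can choose such sets \<open>K\<^sub>0, K\<^sub>1, \<dots>\<close> shrinking so fast that the infinite product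
  \<open>K\<^sub>0 K\<^sub>1 K\<^sub>2 \<dots>\<close> converges uniformly on the compact space \<open>\<Prod>\<^sub>n K\<^sub>n\<close>; its set of values \<open>K\<close> is compact.
  Every nonempty relatively open subset of \<open>K\<close> lets some coordinate run freely through its \<open>K\<^sub>n\<close>,
  so it contains a two-sided translate of \<open>K\<^sub>n\<close> and therefore cannot be translated into \<open>E\<close>.
\<close>

section \<open>Continuity of the group operations, products of groups, small translations\<close>

lemma continuous_map_group_mult:
  assumes "topological_group G T" "continuous_map X T f" "continuous_map X T g"
  shows "continuous_map X T (\<lambda>x. f x \<otimes>\<^bsub>G\<^esub> g x)"
proof -
  have "continuous_map X T ((\<lambda>(x, y). x \<otimes>\<^bsub>G\<^esub> y) \<circ> (\<lambda>x. (f x, g x)))"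
    using assms unfolding topological_group_def
    by (intro continuous_map_compose[of _ "prod_topology T T"])
       (auto intro: continuous_map_pairedI)
  then show ?thesis
    by (simp add: o_def)
qed

lemma topological_group_product:
  assumes "\<And>i. i \<in> I \<Longrightarrow> topological_group (G i) (T i)"
  shows "topological_group (product_group I G) (product_topology T I)"
proof -
  let ?T = "product_topology T I"
  have grp: "\<And>i. i \<in> I \<Longrightarrow> group (G i)"
    and top: "\<And>i. i \<in> I \<Longrightarrow> topspace (T i) = carrier (G i)"
    using assms by (auto simp: topological_group_def)
  have space: "topspace ?T = carrier (product_group I G)"
    by (simp add: top cong: PiE_cong)
  have "continuous_map (prod_topology ?T ?T) ?T (\<lambda>z. \<lambda>i\<in>I. fst z i \<otimes>\<^bsub>G i\<^esub> snd z i)"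
    unfolding continuous_map_componentwise
  proof (intro conjI ballI)
    fix i assume i: "i \<in> I"
    have "continuous_map (prod_topology ?T ?T) (T i) (\<lambda>z. fst z i)"
      "continuous_map (prod_topology ?T ?T) (T i) (\<lambda>z. snd z i)"
      using continuous_map_compose[OF continuous_map_fst continuous_map_product_projection[OF i, of T]]
        continuous_map_compose[OF continuous_map_snd continuous_map_product_projection[OF i, of T]]
      by (auto simp: o_def)
    from continuous_map_group_mult[OF assms[OF i] this]
    show "continuous_map (prod_topology ?T ?T) (T i)
            (\<lambda>z. (\<lambda>i\<in>I. fst z i \<otimes>\<^bsub>G i\<^esub> snd z i) i)"
      using i by simp
  qed auto
  moreover have "continuous_map ?T ?T (\<lambda>x. \<lambda>i\<in>I. inv\<^bsub>G i\<^esub> x i)"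
    unfolding continuous_map_componentwise
  proof (intro conjI ballI)
    fix i assume i: "i \<in> I"
    have "continuous_map (T i) (T i) (\<lambda>x. inv\<^bsub>G i\<^esub> x)"
      using assms[OF i] by (simp add: topological_group_def)
    from continuous_map_compose[OF continuous_map_product_projection[OF i, of T] this]
    show "continuous_map ?T (T i) (\<lambda>x. (\<lambda>i\<in>I. inv\<^bsub>G i\<^esub> x i) i)"
      using i by (simp add: o_def)
  qed auto
  \<comment> \<open>The coordinatewise formula for the inverse in \<open>product_group\<close> is
    available only on the carrier, so continuity is transferred along agreement on the topological
    space.\<close>
  then have "continuous_map ?T ?T (\<lambda>x. inv\<^bsub>product_group I G\<^esub> x)"
    by (rule continuous_map_eq) (simp only: space carrier_product_group inv_product_group grp)
  ultimately show ?thesis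
    using grp space by (simp add: topological_group_def case_prod_unfold)
qed

text \<open>The metric need not be left invariant, so how far \<open>u\<close> moves
  \<open>p\<close> depends on \<open>p\<close>. Compactness of \<open>P\<close> makes one
  neighbourhood of the unit work for all of \<open>P\<close> at once, by the tube lemma around the
  slice over the unit.\<close>

lemma (in Metric_space) small_right_translations:
  assumes tg: "topological_group G mtopology" and P: "compactin mtopology P" and "\<epsilon> > 0"
  obtains U where "closedin mtopology U" "\<one>\<^bsub>G\<^esub> \<in> mtopology interior_of U"
    "\<And>p u. p \<in> P \<Longrightarrow> u \<in> U \<Longrightarrow> d p (p \<otimes>\<^bsub>G\<^esub> u) < \<epsilon>"
proof -
  interpret group G
    using tg by (simp add: topological_group_def)
  have carr: "carrier G = M"
    using tg by (simp add: topological_group_def)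
  let ?TT = "prod_topology mtopology mtopology"
  \<comment> \<open>If a pair (p, u) lies in \<open>O' a\<close>, then \<open>p\<close> and its
    translate by \<open>u\<close> are both within \<epsilon>/2 of \<open>a\<close>, hence within
    \<epsilon> of each other.\<close>
  define O' where "O' a = {z \<in> topspace ?TT. fst z \<in> mball a (\<epsilon>/2)}
      \<inter> {z \<in> topspace ?TT. fst z \<otimes>\<^bsub>G\<^esub> snd z \<in> mball a (\<epsilon>/2)}" for a
  have "continuous_map ?TT mtopology (\<lambda>z. fst z \<otimes>\<^bsub>G\<^esub> snd z)"
    by (rule continuous_map_group_mult[OF tg continuous_map_fst continuous_map_snd])
  then have "openin ?TT (O' a)" for a
    unfolding O'_def
    by (intro openin_Int openin_continuous_map_preimage[OF continuous_map_fst]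
        openin_continuous_map_preimage) auto
  then have "openin ?TT (\<Union>a\<in>P. O' a)"
    by blast
  moreover have PM: "P \<subseteq> M"
    using compactin_subset_topspace[OF P] by simp
  have "P \<times> {\<one>\<^bsub>G\<^esub>} \<subseteq> (\<Union>a\<in>P. O' a)"
  proof clarify
    fix p assume "p \<in> P"
    then have "(p, \<one>\<^bsub>G\<^esub>) \<in> O' p"
      using PM carr one_closed \<open>\<epsilon> > 0\<close> by (auto simp: O'_def)
    with \<open>p \<in> P\<close> show "(p, \<one>\<^bsub>G\<^esub>) \<in> (\<Union>a\<in>P. O' a)"
      by blast
  qed
  moreover have "compactin mtopology {\<one>\<^bsub>G\<^esub>}"
    using carr one_closed by simp
  ultimately obtain A B where "openin mtopology B" "P \<subseteq> A" "{\<one>\<^bsub>G\<^esub>} \<subseteq> B" "A \<times> B \<subseteq> (\<Union>a\<in>P. O' a)"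
    using Wallace_theorem_prod_topology[OF P, of mtopology "{\<one>\<^bsub>G\<^esub>}" "\<Union>a\<in>P. O' a"] by metis
  then have AB: "openin mtopology B" "P \<subseteq> A" "\<one>\<^bsub>G\<^esub> \<in> B" "A \<times> B \<subseteq> (\<Union>a\<in>P. O' a)"
    by auto
  \<comment> \<open>A closed ball inside \<open>B\<close> serves as the closed neighbourhood
    \<open>U\<close>; the open ball of the same radius puts the unit in its interior.\<close>
  then obtain r where r: "r > 0" "mcball \<one>\<^bsub>G\<^esub> r \<subseteq> B"
    by (auto simp: openin_mtopology_mcball)
  show ?thesis
  proof
    show "closedin mtopology (mcball \<one>\<^bsub>G\<^esub> r)"
      by simp
    have "\<one>\<^bsub>G\<^esub> \<in> mball \<one>\<^bsub>G\<^esub> r"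
      using r carr one_closed by simp
    then show "\<one>\<^bsub>G\<^esub> \<in> mtopology interior_of mcball \<one>\<^bsub>G\<^esub> r"
      using interior_of_maximal[OF mball_subset_mcball openin_mball] by blast
    fix p u assume "p \<in> P" "u \<in> mcball \<one>\<^bsub>G\<^esub> r"
    then have "(p, u) \<in> (\<Union>a\<in>P. O' a)"
      using AB r by blast
    then obtain a where "a \<in> M" "p \<in> M" "p \<otimes>\<^bsub>G\<^esub> u \<in> M" "d a p < \<epsilon>/2" "d a (p \<otimes>\<^bsub>G\<^esub> u) < \<epsilon>/2"
      by (auto simp: O'_def)
    then show "d p (p \<otimes>\<^bsub>G\<^esub> u) < \<epsilon>"
      using triangle[of p a "p \<otimes>\<^bsub>G\<^esub> u"] commute[of p a] by linarith
  qed
qed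

section \<open>Partial products and their convergence\<close>

primrec partial_product :: "('a, 'm) monoid_scheme \<Rightarrow> nat \<Rightarrow> (nat \<Rightarrow> 'a) \<Rightarrow> 'a" where
  "partial_product G 0 x = \<one>\<^bsub>G\<^esub>"
| "partial_product G (Suc n) x = partial_product G n x \<otimes>\<^bsub>G\<^esub> x n"

lemma (in group) partial_product_closed:
  "(\<And>i. x i \<in> carrier G) \<Longrightarrow> partial_product G n x \<in> carrier G"
  by (induction n) auto

lemma partial_product_cong:
  "(\<And>i. i < n \<Longrightarrow> x i = y i) \<Longrightarrow> partial_product G n x = partial_product G n y"
  by (induction n) auto

text \<open>The factors after position \<open>n\<close> are written as a quotient of two partial
  products of the original \<open>x\<close>. Thus the elements on either side of \<open>k\<close> do
  not depend on \<open>k\<close>, and \<open>m\<close> occurs only in a partial product whose limit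
  is known.\<close>

lemma (in group) partial_product_update:
  assumes x: "\<And>i. x i \<in> carrier G" and k: "k \<in> carrier G" and "n < m"
  shows "partial_product G m (x(n := k)) =
    partial_product G n x \<otimes> k \<otimes> (inv (partial_product G (Suc n) x) \<otimes> partial_product G m x)"
  using \<open>n < m\<close>
proof (induction m)
  case (Suc m)
  note pc = partial_product_closed[of x, OF x]
  show ?case
  proof (cases "n = m")
    case True
    have "partial_product G n (x(n := k)) = partial_product G n x"
      by (rule partial_product_cong) auto
    then have e1: "partial_product G (Suc m) (x(n := k)) = partial_product G n x \<otimes> k"
      using True by simp
    \<comment> \<open>No factor follows position \<open>n\<close> here, so the quotient collapses to
      the unit.\<close>
    have e2: "inv (partial_product G (Suc n) x) \<otimes> partial_product G (Suc m) x = \<one>"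
      unfolding True by (rule l_inv[OF pc])
    show ?thesis
      by (simp only: e1 e2 pc k m_closed r_one)
  next
    case False
    then have "n < m"
      using Suc.prems by simp
    then show ?thesis
      using Suc.IH False x pc k inv_closed[OF pc[of "Suc n"]]
      by (simp add: m_assoc)
  qed
qed auto

text \<open>The step bounds are summable and do not depend on \<open>x\<close>, so the partial
  products are uniformly Cauchy on the product space. Completeness gives a uniform limit, which is
  continuous because each partial product is.\<close>

lemma (in Metric_space) partial_products_limit:
  assumes tg: "topological_group G mtopology" and "mcomplete"
    and K: "\<And>n. compactin mtopology (K n)"
    and small: "\<And>n x. \<forall>i. x i \<in> K i \<Longrightarrow>
      d (partial_product G n x) (partial_product G (Suc n) x) < (1/2)^n"
  shows "\<exists>g. continuous_map (product_topology (\<lambda>n. subtopology mtopology (K n)) UNIV) mtopology g \<and>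
    (\<forall>x. (\<forall>i. x i \<in> K i) \<longrightarrow>
      limitin mtopology (\<lambda>n. partial_product G n x) (g x) sequentially)"
proof -
  interpret group G
    using tg by (simp add: topological_group_def)
  have carr: "carrier G = M"
    using tg by (simp add: topological_group_def)
  have KM: "K n \<subseteq> M" for n
    using compactin_subset_topspace[OF K] by simp
  \<comment> \<open>With index set \<open>UNIV\<close> the points are simply the functions taking
    values in the \<open>K i\<close>; no extensionality condition remains.\<close>
  let ?X = "product_topology (\<lambda>n. subtopology mtopology (K n)) UNIV"
  have X: "x \<in> topspace ?X \<longleftrightarrow> (\<forall>i. x i \<in> K i)" for x
    using KM by (auto simp: PiE_iff)
  have pM: "partial_product G n x \<in> M" if "x \<in> topspace ?X" for n x
    using partial_product_closed[of x n] that KM carr X by blast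
  have cont: "continuous_map ?X mtopology (partial_product G n)" for n
  proof (induction n)
    case 0
    then show ?case
      using carr one_closed by (simp add: partial_product.simps(1)[abs_def])
  next
    case (Suc n)
    have "continuous_map ?X mtopology (\<lambda>x. x n)"
      using continuous_map_product_projection[of n UNIV "\<lambda>n. subtopology mtopology (K n)"]
      by (auto simp: continuous_map_in_subtopology)
    from continuous_map_group_mult[OF tg Suc this] show ?case
      by (simp add: partial_product.simps(2)[abs_def])
  qed
  \<comment> \<open>The right-hand side is the closed form of the geometric sum of the step bounds
    from \<open>n\<close> to \<open>n + j - 1\<close>.\<close>
  have tele: "d (partial_product G n x) (partial_product G (n + j) x)
      \<le> 2 * (1/2)^n - 2 * (1/2)^(n + j)" if "x \<in> topspace ?X" for n j x
  proof (induction j)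
    case 0
    then show ?case
      using pM[OF that] by simp
  next
    case (Suc j)
    have "d (partial_product G (n + j) x) (partial_product G (Suc (n + j)) x) < (1/2)^(n + j)"
      using small that X by blast
    moreover have "d (partial_product G n x) (partial_product G (Suc (n + j)) x)
        \<le> d (partial_product G n x) (partial_product G (n + j) x)
          + d (partial_product G (n + j) x) (partial_product G (Suc (n + j)) x)"
      by (intro triangle pM that)
    ultimately show ?case
      using Suc by (simp del: partial_product.simps)
  qed
  have near: "d (partial_product G N x) (partial_product G m x) < 2 * (1/2)^N"
    if "x \<in> topspace ?X" "N \<le> m" for N m x
  proof -
    obtain j where m: "m = N + j"
      using \<open>N \<le> m\<close> le_Suc_ex by blast
    have "0 < (1/2::real)^(N + j)"
      by simp
    then show ?thesis
      using tele[OF that(1), of N j] unfolding m by linarith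
  qed
  obtain g where g: "continuous_map ?X mtopology g"
    "\<And>\<epsilon>. 0 < \<epsilon> \<Longrightarrow> \<forall>\<^sub>F n in sequentially. \<forall>x\<in>topspace ?X. d (partial_product G n x) (g x) < \<epsilon>"
  proof (rule continuous_map_uniformly_Cauchy_limit[OF \<open>mcomplete\<close>])
    show "\<forall>\<^sub>F n in sequentially. continuous_map ?X mtopology (partial_product G n)"
      using cont by simp
    fix \<epsilon> :: real assume "\<epsilon> > 0"
    \<comment> \<open>Two partial products beyond \<open>N\<close> are compared through the one at
      \<open>N\<close>; each distance is below twice the \<open>N\<close>-th power of 1/2, hence
      below \<epsilon>/2.\<close>
    then obtain N where N: "(1/2::real)^N < \<epsilon>/4"
      using real_arch_pow_inv[of "\<epsilon>/4" "1/2"] by auto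
    have "d (partial_product G m x) (partial_product G n x) < \<epsilon>"
      if "N \<le> m" "N \<le> n" "x \<in> topspace ?X" for m n x
      using near[OF that(3,1)] near[OF that(3,2)] N
        triangle[OF pM[OF that(3), of m] pM[OF that(3), of N] pM[OF that(3), of n]]
        commute[of "partial_product G m x" "partial_product G N x"]
      by linarith
    then show "\<exists>N. \<forall>m n x. N \<le> m \<longrightarrow> N \<le> n \<longrightarrow> x \<in> topspace ?X \<longrightarrow>
        d (partial_product G m x) (partial_product G n x) < \<epsilon>"
      by blast
  qed (rule that, assumption, blast)
  show ?thesis
  proof (intro exI conjI allI impI)
    show "continuous_map ?X mtopology g"
      by (rule g)
    fix x assume "\<forall>i. x i \<in> K i"
    then have x: "x \<in> topspace ?X"
      using X by blast
    have "g x \<in> M"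
      using continuous_map_image_subset_topspace[OF g(1)] x by auto
    moreover have "\<forall>\<^sub>F n in sequentially. d (partial_product G n x) (g x) < \<epsilon>" if "\<epsilon> > 0" for \<epsilon>
      using g(2)[OF that] by (rule eventually_mono) (use x in blast)
    ultimately show "limitin mtopology (\<lambda>n. partial_product G n x) (g x) sequentially"
      using pM[OF x] by (simp add: limitin_metric)
  qed
qed

text \<open>The sets are chosen recursively: once the first \<open>n\<close> are fixed, all products
  of their elements form a compact set, and the next set is taken inside a neighbourhood of the unit
  whose right translations move that compact set by less than the \<open>n\<close>-th step bound. In
  the application, \<open>Q\<close> says that no two-sided translate lies in
  \<open>E\<close>.\<close>

lemma (in Metric_space) fast_shrinking_sequence:
  assumes tg: "topological_group G mtopology"
    and ex: "\<And>U. closedin mtopology U \<Longrightarrow> \<one>\<^bsub>G\<^esub> \<in> mtopology interior_of U \<Longrightarrow>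
      \<exists>K. compactin mtopology K \<and> K \<subseteq> U \<and> Q K"
  shows "\<exists>K. (\<forall>n. compactin mtopology (K n) \<and> Q (K n)) \<and>
    (\<forall>n x. (\<forall>i. x i \<in> K i) \<longrightarrow>
      d (partial_product G n x) (partial_product G (Suc n) x) < (1/2)^n)"
proof -
  interpret group G
    using tg by (simp add: topological_group_def)
  have carr: "carrier G = M"
    using tg by (simp add: topological_group_def)
  have "\<exists>K. compactin mtopology K \<and> Q K \<and> (\<forall>p\<in>P. \<forall>u\<in>K. d p (p \<otimes>\<^bsub>G\<^esub> u) < (1/2)^n)"
    if P: "compactin mtopology P" for P n
  proof -
    obtain U where "closedin mtopology U" "\<one>\<^bsub>G\<^esub> \<in> mtopology interior_of U"
      "\<And>p u. p \<in> P \<Longrightarrow> u \<in> U \<Longrightarrow> d p (p \<otimes>\<^bsub>G\<^esub> u) < (1/2)^n"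
      using small_right_translations[OF tg P, of "(1/2)^n"] by auto
    with ex[of U] show ?thesis
      by blast
  qed
  then obtain F where F: "\<And>P n. compactin mtopology P \<Longrightarrow> compactin mtopology (F P n)"
    "\<And>P n. compactin mtopology P \<Longrightarrow> Q (F P n)"
    "\<And>P n p u. compactin mtopology P \<Longrightarrow> p \<in> P \<Longrightarrow> u \<in> F P n \<Longrightarrow> d p (p \<otimes>\<^bsub>G\<^esub> u) < (1/2)^n"
    by metis
  \<comment> \<open>\<open>P n\<close> collects all partial products of length \<open>n\<close>; the
    \<open>n\<close>-th chosen set is \<open>F (P n) n\<close>.\<close>
  define P where "P = rec_nat {\<one>\<^bsub>G\<^esub>} (\<lambda>n A. (\<lambda>(p, u). p \<otimes>\<^bsub>G\<^esub> u) ` (A \<times> F A n))"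
  have P0: "P 0 = {\<one>\<^bsub>G\<^esub>}" and PS: "P (Suc n) = (\<lambda>(p, u). p \<otimes>\<^bsub>G\<^esub> u) ` (P n \<times> F (P n) n)" for n
    by (simp_all add: P_def)
  have cP: "compactin mtopology (P n)" for n
  proof (induction n)
    case 0
    then show ?case
      using carr one_closed by (simp add: P0)
  next
    case (Suc n)
    then have "compactin (prod_topology mtopology mtopology) (P n \<times> F (P n) n)"
      using F(1) by (simp add: compactin_Times)
    then show ?case
      unfolding PS using tg by (auto simp: topological_group_def intro: image_compactin)
  qed
  show ?thesis
  proof (intro exI conjI allI impI)
    show "compactin mtopology (F (P n) n)" "Q (F (P n) n)" for n
      using F cP by auto
  next
    fix n and x :: "nat \<Rightarrow> 'a" assume x: "\<forall>i. x i \<in> F (P i) i"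
    have "partial_product G n x \<in> P n"
    proof (induction n)
      case (Suc n)
      then show ?case
        using x by (force simp: PS)
    qed (simp add: P0)
    then show "d (partial_product G n x) (partial_product G (Suc n) x) < (1/2)^n"
      using F(3)[OF cP] x by simp
  qed
qed

section \<open>Fattening from complete metrizability\<close>

theorem completely_metrizable_group_fattening:
  assumes tg: "topological_group G T" and cm: "completely_metrizable_space T"
  shows "fattening G T"
proof -
  obtain M d where md: "Metric_space M d" "Metric_space.mcomplete M d"
    and T: "T = Metric_space.mtopology M d"
    using cm by (auto simp: completely_metrizable_space_def)
  interpret Metric_space M d
    by (rule md)
  interpret group G
    using tg by (simp add: topological_group_def)
  have carr: "carrier G = M"
    using tg by (simp add: topological_group_def T)
  have tgM: "topological_group G mtopology"
    using tg T by simp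
  have "strongly_compactivorous G mtopology E" if E: "compactivorous G mtopology E" for E
  proof (rule ccontr)
    \<comment> \<open>Failure of strong compactivorousness provides a compact set satisfying
      \<open>Q\<close> inside every closed neighbourhood of the unit.\<close>
    define Q where "Q K \<longleftrightarrow> (\<forall>g\<in>carrier G. \<forall>h\<in>carrier G. \<not> (\<lambda>x. g \<otimes>\<^bsub>G\<^esub> x \<otimes>\<^bsub>G\<^esub> h) ` K \<subseteq> E)" for K
    assume "\<not> strongly_compactivorous G mtopology E"
    moreover have "E \<subseteq> carrier G"
      using E by (simp add: compactivorous_def)
    ultimately have "\<exists>K. compactin mtopology K \<and> K \<subseteq> U \<and>
        \<not> (\<exists>g\<in>carrier G. \<exists>h\<in>carrier G. (\<lambda>x. g \<otimes>\<^bsub>G\<^esub> x \<otimes>\<^bsub>G\<^esub> h) ` K \<subseteq> E)"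
      if "closedin mtopology U" "\<one>\<^bsub>G\<^esub> \<in> mtopology interior_of U" for U
      using that unfolding strongly_compactivorous_def by meson
    then have "\<exists>K. compactin mtopology K \<and> K \<subseteq> U \<and> Q K"
      if "closedin mtopology U" "\<one>\<^bsub>G\<^esub> \<in> mtopology interior_of U" for U
      using that unfolding Q_def by simp
    from fast_shrinking_sequence[of G Q, OF tgM this] obtain K where K: "\<And>n. compactin mtopology (K n)" "\<And>n. Q (K n)"
      and small: "\<And>n x. \<forall>i. x i \<in> K i \<Longrightarrow>
        d (partial_product G n x) (partial_product G (Suc n) x) < (1/2)^n"
      by blast
    let ?X = "product_topology (\<lambda>n. subtopology mtopology (K n)) UNIV"
    obtain f where f: "continuous_map ?X mtopology f"
      and lim: "\<And>x. \<forall>i. x i \<in> K i \<Longrightarrow>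
        limitin mtopology (\<lambda>n. partial_product G n x) (f x) sequentially"
      using partial_products_limit[of G K, OF tgM md(2) K(1) small] by metis
    have KM: "K n \<subseteq> M" for n
      using compactin_subset_topspace[OF K(1)] by simp
    have X: "topspace ?X = {x. \<forall>i. x i \<in> K i}"
      using KM by (auto simp: PiE_iff)
    \<comment> \<open>The empty set translates into \<open>E\<close> vacuously, so \<open>Q\<close>
      excludes it. Nonemptiness makes the image of \<open>f\<close> a legitimate test set for
      compactivorousness.\<close>
    have "K n \<noteq> {}" for n
      using K(2)[of n] one_closed by (auto simp: Q_def)
    then have "(\<lambda>n. SOME k. k \<in> K n) \<in> topspace ?X"
      unfolding X by (simp add: some_in_eq)
    then have "f ` topspace ?X \<noteq> {}"
      by blast
    moreover have "compact_space ?X"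
      using K(1) by (simp add: compact_space_product_topology compact_space_subtopology)
    then have "compactin mtopology (f ` topspace ?X)"
      using image_compactin[OF _ f] by (simp add: compact_space_def)
    ultimately obtain V g h where V: "openin mtopology V" and gh: "g \<in> carrier G" "h \<in> carrier G"
      and ne: "f ` topspace ?X \<inter> V \<noteq> {}"
      and sub: "(\<lambda>x. g \<otimes>\<^bsub>G\<^esub> x \<otimes>\<^bsub>G\<^esub> h) ` (f ` topspace ?X \<inter> V) \<subseteq> E"
      using E unfolding compactivorous_def by meson
    from ne obtain x where x: "x \<in> topspace ?X" "f x \<in> V"
      by blast
    \<comment> \<open>The preimage of \<open>V\<close> under \<open>f\<close> is open, so it
      contains a basic box around \<open>x\<close>, which restricts only finitely many
      coordinates.\<close>
    have "x \<in> {x \<in> topspace ?X. f x \<in> V}"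
      using x by simp
    then have "\<exists>W. finite {i \<in> UNIV. W i \<noteq> topspace (subtopology mtopology (K i))} \<and>
        (\<forall>i\<in>UNIV. openin (subtopology mtopology (K i)) (W i)) \<and>
        x \<in> PiE UNIV W \<and> PiE UNIV W \<subseteq> {x \<in> topspace ?X. f x \<in> V}"
      using openin_continuous_map_preimage[OF f V]
      unfolding openin_product_topology_alt by (rule bspec[rotated])
    then obtain W where W: "finite {i. W i \<noteq> topspace (subtopology mtopology (K i))}"
      "x \<in> PiE UNIV W" "PiE UNIV W \<subseteq> {x \<in> topspace ?X. f x \<in> V}"
      by auto
    \<comment> \<open>A coordinate that the box leaves free: it may run through all of
      \<open>K n\<close> while \<open>f\<close> stays in \<open>V\<close>.\<close>
    obtain n where n: "W n = topspace (subtopology mtopology (K n))"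
      using ex_new_if_finite[OF infinite_UNIV_nat W(1)] by blast
    have xK: "x i \<in> K i" and xc: "x i \<in> carrier G" for i
      using x(1) KM carr unfolding X by blast+
    \<comment> \<open>\<open>a\<close> is the product of the factors before position
      \<open>n\<close>. Multiplying \<open>f x\<close> on the left by \<open>b\<close> cancels the
      factors up to and including position \<open>n\<close>, leaving the infinite tail.\<close>
    define a where "a = partial_product G n x"
    define b where "b = inv\<^bsub>G\<^esub> (partial_product G (Suc n) x)"
    have ac: "a \<in> carrier G" and bc: "b \<in> carrier G"
      using partial_product_closed[OF xc] inv_closed by (auto simp: a_def b_def simp del: partial_product.simps)
    have fx: "f x \<in> carrier G"
      using limitin_topspace[OF lim[OF allI[OF xK]]] carr by simp
    \<comment> \<open>This is \<open>partial_product_update\<close> in the limit: for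
      \<open>m\<close> beyond \<open>n\<close> the two sides agree at the level of partial products,
      multiplication by fixed elements is continuous, and limits in a metric space are
      unique.\<close>
    have upd: "f (x(n := k)) = a \<otimes>\<^bsub>G\<^esub> k \<otimes>\<^bsub>G\<^esub> (b \<otimes>\<^bsub>G\<^esub> f x)" if k: "k \<in> K n" for k
    proof -
      have kc: "k \<in> carrier G"
        using k KM carr by blast
      have const: "continuous_map mtopology mtopology (\<lambda>_. c)" if "c \<in> carrier G" for c
        using that carr by simp
      have "continuous_map mtopology mtopology (\<lambda>y. a \<otimes>\<^bsub>G\<^esub> k \<otimes>\<^bsub>G\<^esub> (b \<otimes>\<^bsub>G\<^esub> y))"
        using ac bc kc by (intro continuous_map_group_mult[OF tgM] const continuous_map_id[unfolded id_def]) auto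
      from continuous_map_limit[OF this lim[OF allI[OF xK]]]
      have "limitin mtopology (\<lambda>m. a \<otimes>\<^bsub>G\<^esub> k \<otimes>\<^bsub>G\<^esub> (b \<otimes>\<^bsub>G\<^esub> partial_product G m x))
              (a \<otimes>\<^bsub>G\<^esub> k \<otimes>\<^bsub>G\<^esub> (b \<otimes>\<^bsub>G\<^esub> f x)) sequentially"
        by (simp add: o_def)
      moreover have "\<forall>\<^sub>F m in sequentially.
          a \<otimes>\<^bsub>G\<^esub> k \<otimes>\<^bsub>G\<^esub> (b \<otimes>\<^bsub>G\<^esub> partial_product G m x) = partial_product G m (x(n := k))"
        using eventually_gt_at_top[of n]
        by (rule eventually_mono) (use partial_product_update[OF xc kc] in \<open>simp only: a_def b_def\<close>)
      ultimately have "limitin mtopology (\<lambda>m. partial_product G m (x(n := k)))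
              (a \<otimes>\<^bsub>G\<^esub> k \<otimes>\<^bsub>G\<^esub> (b \<otimes>\<^bsub>G\<^esub> f x)) sequentially"
        by (rule limitin_transform_eventually[rotated])
      moreover have "limitin mtopology (\<lambda>m. partial_product G m (x(n := k)))
              (f (x(n := k))) sequentially"
        using k xK by (intro lim) auto
      ultimately show ?thesis
        using limitin_metric_unique trivial_limit_sequentially by blast
    qed
    \<comment> \<open>Absorbing the fixed factors into \<open>g\<close> and \<open>h\<close> yields
      a two-sided translate of the whole of \<open>K n\<close> inside \<open>E\<close>, against
      \<open>Q (K n)\<close>.\<close>
    have "(\<lambda>y. (g \<otimes>\<^bsub>G\<^esub> a) \<otimes>\<^bsub>G\<^esub> y \<otimes>\<^bsub>G\<^esub> ((b \<otimes>\<^bsub>G\<^esub> f x) \<otimes>\<^bsub>G\<^esub> h)) ` K n \<subseteq> E"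
    proof (rule image_subsetI)
      fix k assume k: "k \<in> K n"
      then have kc: "k \<in> carrier G"
        using KM carr by blast
      have "x(n := k) \<in> PiE UNIV W"
        using W(2) n k KM by (auto simp: PiE_iff)
      then have "f (x(n := k)) \<in> f ` topspace ?X \<inter> V"
        using W(3) by blast
      then have "g \<otimes>\<^bsub>G\<^esub> f (x(n := k)) \<otimes>\<^bsub>G\<^esub> h \<in> E"
        using sub by blast
      then show "(g \<otimes>\<^bsub>G\<^esub> a) \<otimes>\<^bsub>G\<^esub> k \<otimes>\<^bsub>G\<^esub> ((b \<otimes>\<^bsub>G\<^esub> f x) \<otimes>\<^bsub>G\<^esub> h) \<in> E"
        using upd[OF k] gh ac bc kc fx by (simp add: m_assoc)
    qed
    moreover have "g \<otimes>\<^bsub>G\<^esub> a \<in> carrier G" "(b \<otimes>\<^bsub>G\<^esub> f x) \<otimes>\<^bsub>G\<^esub> h \<in> carrier G"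
      using gh ac bc fx by auto
    ultimately show False
      using K(2)[of n] unfolding Q_def by blast
  qed
  then show ?thesis
    using tgM Hausdorff_space_mtopology by (simp add: fattening_def T)
qed

theorem theorem5p2:
  fixes G :: "nat \<Rightarrow> 'a monoid" and T :: "nat \<Rightarrow> 'a topology"
  assumes "\<And>n. n \<in> {1..} \<Longrightarrow> polish_group (G n) (T n)"
    and "\<And>n. n \<in> {1..} \<Longrightarrow> locally_compact_space (T n)"
  shows "fattening (product_group {1..} G) (product_topology T {1..})"
proof (rule completely_metrizable_group_fattening)
  show "topological_group (product_group {1..} G) (product_topology T {1..})"
    using assms(1) by (intro topological_group_product) (auto simp: polish_group_def)
  \<comment> \<open>A product of completely metrizable spaces is completely metrizable when at most
    countably many factors have more than one point; here the indices are natural numbers.\<close>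
  show "completely_metrizable_space (product_topology T {1..})"
    using assms(1) by (simp add: completely_metrizable_space_product_topology polish_group_def)
qed

end
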